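(* The Greedy Algorithm achieves approximation ratio $$1+\frac{\tau^*}{\mathsf{opt}}\ln\frac{\nu_0-\nu^*}{\tau^*}=1+\frac{\tau^*}{\mathsf{opt}}\cdot\ln\left(1+\frac{\nu_0-\mathsf{opt}}{\tau^*}\right).$$
   Context: Generalized Min-Covering: given non-negative set functions $\nu,\tau$ on subsets of a ground set $U$, with $\nu$ decreasing, $\tau$ sub-additive and $\tau(\emptyset)=0$, find $A\subseteq U$ minimizing $\nu(A)+\tau(A)$. Fix an optimal solution $A^*$, let $\nu^*=\nu(A^* )$, $\tau^*=\tau(A^* )$, $\mathsf{opt}=\tau^*+\nu^*$, and $\nu_0=\nu(\emptyset)$. The Greedy Algorithm starts with $A=\emptyset$ and, while $\nu(A)>\nu^*$, repeatedly adds to $A$ a non-empty set $B$ satisfying the density condition $\frac{\tau(B)}{\nu(A)-\nu(A\cup B)}\le\min\left\{1,\frac{\tau^*}{\nu(A)-\nu^*}\right\}$, as long as such $B$ exists. *)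

theory Defs
  imports Complex_Main
begin

definition set_subadditive_on :: "'a set \<Rightarrow> ('a set \<Rightarrow> real) \<Rightarrow> bool" where
  "set_subadditive_on U \<tau> \<longleftrightarrow>
     (\<forall>A B. A \<subseteq> U \<longrightarrow> B \<subseteq> U \<longrightarrow> \<tau> (A \<union> B) \<le> \<tau> A + \<tau> B)"

definition optimal_solution ::
  "'a set \<Rightarrow> ('a set \<Rightarrow> real) \<Rightarrow> ('a set \<Rightarrow> real) \<Rightarrow> 'a set \<Rightarrow> bool" where
  "optimal_solution U \<nu> \<tau> A \<longleftrightarrow>
     A \<subseteq> U \<and> (\<forall>A'. A' \<subseteq> U \<longrightarrow> \<nu> A + \<tau> A \<le> \<nu> A' + \<tau> A')"

text \<open>
  A density with denominator \<open>0\<close> is undefined and does not meet the density condition. The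
  explicit strict inequality is needed because \<open>x / 0 = 0\<close> for reals in HOL.
\<close>

definition density_condition ::
  "('a set \<Rightarrow> real) \<Rightarrow> ('a set \<Rightarrow> real) \<Rightarrow> real \<Rightarrow> real \<Rightarrow> 'a set \<Rightarrow> 'a set \<Rightarrow> bool" where
  "density_condition \<nu> \<tau> \<nu>s \<tau>s A B \<longleftrightarrow>
     \<nu> (A \<union> B) < \<nu> A \<and>
     \<tau> B / (\<nu> A - \<nu> (A \<union> B)) \<le> min 1 (\<tau>s / (\<nu> A - \<nu>s))"

definition greedy_step ::
  "'a set \<Rightarrow> ('a set \<Rightarrow> real) \<Rightarrow> ('a set \<Rightarrow> real) \<Rightarrow> real \<Rightarrow> real \<Rightarrow> 'a set \<Rightarrow> 'a set \<Rightarrow> bool" where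
  "greedy_step U \<nu> \<tau> \<nu>s \<tau>s A A' \<longleftrightarrow>
     \<nu> A > \<nu>s \<and>
     (\<exists>B. B \<subseteq> U \<and> B \<noteq> {} \<and> density_condition \<nu> \<tau> \<nu>s \<tau>s A B \<and> A' = A \<union> B)"

text \<open>
  The choice of \<open>B\<close> is nondeterministic, so an instance may have several outputs.
\<close>

definition greedy_output ::
  "'a set \<Rightarrow> ('a set \<Rightarrow> real) \<Rightarrow> ('a set \<Rightarrow> real) \<Rightarrow> real \<Rightarrow> real \<Rightarrow> 'a set \<Rightarrow> bool" where
  "greedy_output U \<nu> \<tau> \<nu>s \<tau>s A \<longleftrightarrow>
     (greedy_step U \<nu> \<tau> \<nu>s \<tau>s)\<^sup>*\<^sup>* {} A \<and> (\<nexists>A'. greedy_step U \<nu> \<tau> \<nu>s \<tau>s A A')"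

definition greedy_infinite_run ::
  "'a set \<Rightarrow> ('a set \<Rightarrow> real) \<Rightarrow> ('a set \<Rightarrow> real) \<Rightarrow> real \<Rightarrow> real \<Rightarrow> (nat \<Rightarrow> 'a set) \<Rightarrow> bool" where
  "greedy_infinite_run U \<nu> \<tau> \<nu>s \<tau>s f \<longleftrightarrow>
     f 0 = {} \<and> (\<forall>i. greedy_step U \<nu> \<tau> \<nu>s \<tau>s (f i) (f (Suc i)))"

end

theory Submission
  imports Defs
begin

text \<open>
  Write \<open>x = \<nu>(A) - \<nu>\<^sup>*\<close>. A greedy step lowering \<open>x\<close> to \<open>y\<close> costs at most \<open>(x - y) min {1, \<tau>\<^sup>*/x}\<close>,
  which is at most the integral of the decreasing function \<open>min {1, \<tau>\<^sup>*/t}\<close> over \<open>[y, x]\<close>. So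
  \<open>\<tau>(A)\<close> plus the antiderivative at \<open>x\<close> never exceeds the initial value of the antiderivative.
  If \<open>x > \<tau>\<^sup>*\<close>, then \<open>A\<^sup>*\<close> itself satisfies the density condition, so the algorithm stops only
  when \<open>x \<le> \<tau>\<^sup>*\<close>, where the antiderivative is \<open>x\<close>. Its initial value is
  \<open>\<tau>\<^sup>* + \<tau>\<^sup>* ln ((\<nu>\<^sub>0 - \<nu>\<^sup>*)/\<tau>\<^sup>*)\<close>, since optimality against the empty set gives \<open>\<nu>\<^sub>0 - \<nu>\<^sup>* \<ge> \<tau>\<^sup>*\<close>.
\<close>

text \<open>
  The antiderivative of \<open>min {1, s/t}\<close>. For \<open>s = 0\<close> and \<open>x > 0\<close> its value is \<open>0\<close>, as it should be.
\<close>

definition greedy_potential :: "real \<Rightarrow> real \<Rightarrow> real" where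
  "greedy_potential s x = (if x \<le> s then x else s + s * ln (x / s))"

text \<open>From \<open>ln z \<le> z - 1\<close> at \<open>z = y / x\<close>. The right side is the
  integral of \<open>s / t\<close> over \<open>[y, x]\<close>, the left side its lower bound by the
  least value \<open>s / x\<close>.\<close>

lemma mult_one_minus_le_ln:
  fixes s x y :: real
  assumes "0 \<le> s" "0 < x" "0 < y"
  shows "s * (1 - y / x) \<le> s * (ln x - ln y)"
proof -
  have "ln (y / x) \<le> y / x - 1" using assms by (intro ln_le_minus_one) simp
  then have "1 - y / x \<le> ln x - ln y" using assms by (simp add: ln_div)
  then show ?thesis using assms by (intro mult_left_mono)
qed

text \<open>\<open>y\<close> may be negative because a step can push \<nu> below its optimal part;
  there the potential is the identity.\<close>

lemma greedy_potential_decrease: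
  assumes s: "0 \<le> s" and x: "0 < x" and y: "y \<le> x"
  shows "(x - y) * min 1 (s / x) \<le> greedy_potential s x - greedy_potential s y"
proof (cases "x \<le> s")
  case True
  then have "min 1 (s / x) = 1" using x by simp
  then show ?thesis using True y by (simp add: greedy_potential_def)
next
  case xs: False
  have "(x - y) * min 1 (s / x) \<le> (x - y) * (s / x)"
    using y by (intro mult_left_mono) auto
  also have "\<dots> = s - y * (s / x)" using x by (simp add: field_simps)
  also have "\<dots> \<le> greedy_potential s x - greedy_potential s y"
  proof (cases "s = 0")
    case True
    then show ?thesis using xs by (simp add: greedy_potential_def)
  next
    case False
    then have s_pos: "0 < s" using s by simp
    show ?thesis
    proof (cases "y \<le> s")
      case True
      \<comment> \<open>The interval straddles \<open>s\<close>. Raising \<open>y\<close> to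
        \<open>s\<close>, harmless since \<open>1 - s / x \<ge> 0\<close>, gives the logarithm bound
        a positive argument.\<close>
      have "y * (1 - s / x) \<le> s * (1 - s / x)"
        using True xs x by (intro mult_right_mono) auto
      also have "\<dots> \<le> s * (ln x - ln s)"
        using s x s_pos by (rule mult_one_minus_le_ln)
      finally show ?thesis
        using True xs x s_pos by (simp add: greedy_potential_def ln_div right_diff_distrib)
    next
      case False
      then have "s * (1 - y / x) \<le> s * (ln x - ln y)"
        using s x s_pos by (intro mult_one_minus_le_ln) auto
      then show ?thesis
        using False xs x s_pos by (simp add: greedy_potential_def ln_div algebra_simps)
    qed
  qed
  finally show ?thesis .
qed

lemma greedy_step_subset:
  assumes "greedy_step U \<nu> \<tau> \<nu>s \<tau>s A A'" "A \<subseteq> U"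
  shows "A' \<subseteq> U"
  using assms by (auto simp: greedy_step_def)

text \<open>The strict drop of \<nu> excludes \<open>B \<subseteq> A\<close>.\<close>

lemma greedy_step_psubset:
  assumes "greedy_step U \<nu> \<tau> \<nu>s \<tau>s A A'"
  shows "A \<subset> A'"
  using assms by (auto simp: greedy_step_def density_condition_def)

lemma greedy_step_potential:
  assumes step: "greedy_step U \<nu> \<tau> \<nu>s \<tau>s A A'" and A: "A \<subseteq> U"
    and sub: "set_subadditive_on U \<tau>" and s: "0 \<le> \<tau>s"
  shows "\<tau> A' + greedy_potential \<tau>s (\<nu> A' - \<nu>s) \<le> \<tau> A + greedy_potential \<tau>s (\<nu> A - \<nu>s)"
proof -
  obtain B where B: "B \<subseteq> U" "A' = A \<union> B" and gt: "\<nu> A > \<nu>s" and less: "\<nu> A' < \<nu> A"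
    and dens: "\<tau> B / (\<nu> A - \<nu> A') \<le> min 1 (\<tau>s / (\<nu> A - \<nu>s))"
    using step unfolding greedy_step_def density_condition_def by blast
  have "\<tau> B \<le> (\<nu> A - \<nu> A') * min 1 (\<tau>s / (\<nu> A - \<nu>s))"
    using dens less by (simp only: pos_divide_le_eq diff_gt_0_iff_gt mult.commute)
  also have "\<dots> \<le> greedy_potential \<tau>s (\<nu> A - \<nu>s) - greedy_potential \<tau>s (\<nu> A' - \<nu>s)"
    using greedy_potential_decrease[OF s, of "\<nu> A - \<nu>s" "\<nu> A' - \<nu>s"] gt less by simp
  finally have "\<tau> B \<le> greedy_potential \<tau>s (\<nu> A - \<nu>s) - greedy_potential \<tau>s (\<nu> A' - \<nu>s)" .
  moreover have "\<tau> A' \<le> \<tau> A + \<tau> B"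
    using sub A B by (simp add: set_subadditive_on_def)
  ultimately show ?thesis by linarith
qed

lemma greedy_run_potential:
  assumes run: "(greedy_step U \<nu> \<tau> \<nu>s \<tau>s)\<^sup>*\<^sup>* {} A"
    and sub: "set_subadditive_on U \<tau>" and s: "0 \<le> \<tau>s"
  shows "A \<subseteq> U \<and> \<tau> A + greedy_potential \<tau>s (\<nu> A - \<nu>s)
    \<le> \<tau> {} + greedy_potential \<tau>s (\<nu> {} - \<nu>s)"
  using run
proof (induction rule: rtranclp_induct)
  case base
  show ?case by simp
next
  case (step A A')
  then show ?case
    using greedy_step_subset[OF step(2)] greedy_step_potential[OF step(2) _ sub s] by auto
qed

text \<open>Each step adds at least one element, so \<open>card U + 1\<close> steps would overfill
  \<open>U\<close>.\<close>

lemma no_greedy_infinite_run: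
  assumes fin: "finite U"
  shows "\<not> greedy_infinite_run U \<nu> \<tau> \<nu>s \<tau>s f"
proof
  assume "greedy_infinite_run U \<nu> \<tau> \<nu>s \<tau>s f"
  then have f0: "f 0 = {}" and step: "\<And>i. greedy_step U \<nu> \<tau> \<nu>s \<tau>s (f i) (f (Suc i))"
    by (auto simp: greedy_infinite_run_def)
  have sub: "f i \<subseteq> U" for i
    by (induction i) (simp_all add: f0 greedy_step_subset[OF step])
  have "i \<le> card (f i)" for i
  proof (induction i)
    case (Suc i)
    have "card (f i) < card (f (Suc i))"
      using greedy_step_psubset[OF step] finite_subset[OF sub fin] by (rule psubset_card_mono[rotated])
    with Suc show ?case by simp
  qed simp
  from this[of "Suc (card U)"] card_mono[OF fin sub, of "Suc (card U)"] show False by simp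
qed

text \<open>Monotonicity makes the drop at least \<open>\<nu> A - \<nu> Astar\<close>, and
  \<open>gt\<close> makes the quotient the smaller term of the minimum.\<close>

lemma greedy_step_Astar:
  assumes A: "A \<subseteq> U" and Astar: "Astar \<subseteq> U" "Astar \<noteq> {}"
    and dec: "antimono_on (Pow U) \<nu>"
    and nonneg: "0 \<le> \<tau> Astar" and gt: "\<tau> Astar < \<nu> A - \<nu> Astar"
  shows "greedy_step U \<nu> \<tau> (\<nu> Astar) (\<tau> Astar) A (A \<union> Astar)"
proof -
  have le: "\<nu> (A \<union> Astar) \<le> \<nu> Astar"
    using A Astar by (intro monotone_onD[OF dec]) auto
  have "\<tau> Astar / (\<nu> A - \<nu> (A \<union> Astar)) \<le> \<tau> Astar / (\<nu> A - \<nu> Astar)"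
    using le gt nonneg by (intro divide_left_mono mult_pos_pos) auto
  moreover have "\<tau> Astar / (\<nu> A - \<nu> Astar) \<le> 1"
    using gt nonneg by simp
  ultimately have "density_condition \<nu> \<tau> (\<nu> Astar) (\<tau> Astar) A Astar"
    using le gt nonneg by (auto simp: density_condition_def)
  then show ?thesis
    using Astar gt nonneg by (auto simp: greedy_step_def)
qed

theorem theorem4:
  fixes U :: "'a set" and \<nu> \<tau> :: "'a set \<Rightarrow> real" and Astar :: "'a set"
    and nu_star tau_star opt nu0 :: real
  assumes nu_nonneg: "\<And>A. A \<subseteq> U \<Longrightarrow> \<nu> A \<ge> 0"
    and tau_nonneg: "\<And>A. A \<subseteq> U \<Longrightarrow> \<tau> A \<ge> 0"
    and nu_decreasing: "antimono_on (Pow U) \<nu>"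
    and tau_subadditive: "set_subadditive_on U \<tau>"
    and tau_empty: "\<tau> {} = 0"
    and Astar_optimal: "optimal_solution U \<nu> \<tau> Astar"
    and nu_star: "nu_star = \<nu> Astar"
    and tau_star: "tau_star = \<tau> Astar"
    and opt: "opt = tau_star + nu_star"
    and nu0: "nu0 = \<nu> {}"
  shows "(finite U \<longrightarrow> (\<nexists>f. greedy_infinite_run U \<nu> \<tau> nu_star tau_star f)) \<and>
    (\<forall>A. greedy_output U \<nu> \<tau> nu_star tau_star A \<longrightarrow>
       A \<subseteq> U \<and>
       \<nu> A + \<tau> A \<le> (1 + tau_star / opt * ln ((nu0 - nu_star) / tau_star)) * opt) \<and>
    1 + tau_star / opt * ln ((nu0 - nu_star) / tau_star) =
    1 + tau_star / opt * ln (1 + (nu0 - opt) / tau_star)"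
proof (intro conjI impI allI)
  show "\<nexists>f. greedy_infinite_run U \<nu> \<tau> nu_star tau_star f" if "finite U"
    using no_greedy_infinite_run[OF that] by blast
next
  have Astar_sub: "Astar \<subseteq> U" and opt_le: "opt \<le> nu0"
    using Astar_optimal tau_empty empty_subsetI[of U]
    unfolding optimal_solution_def opt nu_star tau_star nu0
    by (metis, metis add.commute add.right_neutral)
  have tau_star_nonneg: "0 \<le> tau_star"
    using tau_nonneg[OF Astar_sub] by (simp add: tau_star)
  have nu_star_nonneg: "0 \<le> nu_star"
    using nu_nonneg[OF Astar_sub] by (simp add: nu_star)
  fix A
  assume out: "greedy_output U \<nu> \<tau> nu_star tau_star A"
  then have A: "A \<subseteq> U"
    and pot: "\<tau> A + greedy_potential tau_star (\<nu> A - nu_star)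
      \<le> greedy_potential tau_star (nu0 - nu_star)"
    using greedy_run_potential[OF _ tau_subadditive tau_star_nonneg, of \<nu> nu_star A]
    by (auto simp: greedy_output_def tau_empty nu0)
  show "A \<subseteq> U" by (rule A)
  have "\<nu> A - nu_star \<le> tau_star"
  proof (rule ccontr)
    assume "\<not> \<nu> A - nu_star \<le> tau_star"
    then have gt: "\<tau> Astar < \<nu> A - \<nu> Astar" by (simp add: nu_star tau_star)
    have "\<nu> A \<le> \<nu> {}"
      using A by (intro monotone_onD[OF nu_decreasing]) auto
    \<comment> \<open>If \<open>Astar\<close> were empty, \<open>gt\<close> would read
      \<open>\<nu> {} < \<nu> A\<close>.\<close>
    then have "Astar \<noteq> {}" using gt tau_empty by auto
    from greedy_step_Astar[OF A Astar_sub this nu_decreasing, of \<tau>] show False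
      using gt tau_star_nonneg out by (auto simp: greedy_output_def nu_star tau_star)
  qed
  then have "\<tau> A + (\<nu> A - nu_star) \<le> greedy_potential tau_star (nu0 - nu_star)"
    using pot by (simp add: greedy_potential_def)
  also have "\<dots> = tau_star + tau_star * ln ((nu0 - nu_star) / tau_star)"
  \<comment> \<open>At equality the logarithmic term vanishes: it is \<open>ln 1\<close>, or has
    factor \<open>0\<close> if \<open>tau_star = 0\<close>.\<close>
  proof (cases "nu0 - nu_star = tau_star")
    case True
    then show ?thesis by (simp add: greedy_potential_def)
  next
    case False
    then have "\<not> nu0 - nu_star \<le> tau_star" using opt_le opt by linarith
    then show ?thesis by (simp add: greedy_potential_def)
  qed
  finally have "\<nu> A + \<tau> A \<le> opt + tau_star * ln ((nu0 - nu_star) / tau_star)"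
    by (simp add: opt)
  also have "\<dots> = (1 + tau_star / opt * ln ((nu0 - nu_star) / tau_star)) * opt"
  proof (cases "opt = 0")
    case True
    \<comment> \<open>Here \<open>tau_star / opt\<close> is \<open>0 / 0 = 0\<close>, and both sides
      are \<open>0\<close>.\<close>
    then have "tau_star = 0" using opt tau_star_nonneg nu_star_nonneg by simp
    then show ?thesis by simp
  qed (simp add: distrib_right)
  finally show "\<nu> A + \<tau> A \<le> (1 + tau_star / opt * ln ((nu0 - nu_star) / tau_star)) * opt" .
next
  show "1 + tau_star / opt * ln ((nu0 - nu_star) / tau_star) =
    1 + tau_star / opt * ln (1 + (nu0 - opt) / tau_star)"
  \<comment> \<open>For \<open>tau_star = 0\<close> the factor \<open>tau_star / opt\<close> is
    \<open>0\<close> and removes both logarithms.\<close>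
  proof (cases "tau_star = 0")
    case False
    then have "(nu0 - nu_star) / tau_star = 1 + (nu0 - opt) / tau_star"
      by (simp add: opt field_simps)
    then show ?thesis by simp
  qed simp
qed

end
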